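(* Let $\chi,\mu$ be probability measures on $\mathbb{R}$ and $\ddot\mu$ a symmetrization of $\mu$. Suppose that $\chi$ is absolutely continuous with density $f_\chi$, that the density $f_{\chi*\ddot\mu}$ of $\chi*\ddot\mu$ is continuous, and that $\iota$ is an absolutely continuous probability measure on $\mathbb{R}$ with density satisfying $f_\iota(\xi) = \mathcal{O}(\xi^{-2})$ as $\xi\to\pm\infty$ and with $\Phi_\iota\in L^1(\mathbb{R})$. Let $\mathfrak{d}(\cdot,m)$ be the deconvolution density. If $\Phi_\chi\in L^1(\mathbb{R})$, then the limit $\lim_{m\to\infty}\|\mathfrak{d}(\cdot,m)-f_\chi\|_\infty$ exists and lies in $[0,\infty)$. The limit equals zero if $\mathcal{N}_\mu\setminus\mathcal{N}_\chi$ has zero Lebesgue measure.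
   Context: Measures are finite signed Borel measures on $\mathbb{R}$. $F_\nu(\xi) := \nu((-\infty,\xi])$, $\Phi_\nu(t) := \int e^{itx}\,\nu(dx)$, and $\mathcal{N}_\nu := \{t \in \mathbb{R}\cup\{\pm\infty\} : \Phi_\nu(t)=0\}$, where $\pm\infty \in \mathcal{N}_\nu$ means $\lim_{t\to\pm\infty}\Phi_\nu(t)=0$. Absolute continuity is with respect to Lebesgue measure, and $f_\nu$ denotes the density. $\nu^{*0}:=\delta_{\{0\}}$, $\nu^{*k} := \nu * \nu^{*(k-1)}$, and $F_\nu^{*k}$ is the distribution function of $\nu^{*k}$. A symmetrization of $\mu$ is a probability measure $\ddot\mu = \mu*\eta$, with $\eta$ a probability measure, such that $F_{\ddot\mu}(\xi-)=1-F_{\ddot\mu}(-\xi)$ for all $\xi$, $\Phi_{\ddot\mu}=\Phi_\mu\Phi_\eta$ is even with $0\le\Phi_{\ddot\mu}\le1$, and $\mathcal{N}_{\ddot\mu}=\mathcal{N}_\mu$. Put $\pi_{\ddot\mu} := \delta_{\{0\}} - \ddot\mu$, $\mathfrak{K}_{\ddot\mu}(\xi,m) := \sum_{\ell=0}^m F_{\pi_{\ddot\mu}}^{*\ell}(\xi)$. The deconvolution density is $\mathfrak{d}(\xi,m) := \int_{-\infty}^\infty f_{\chi*\ddot\mu}(\xi-x)\,\mathfrak{K}_{\ddot\mu}(dx,m)$, for $(\xi,m)\in\mathbb{R}\times\mathbb{N}_0$. $\|\cdot\|_\infty$ is the $L^\infty(\mathbb{R})$-norm. *)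

theory Defs
  imports
    "HOL-Probability.Probability"
    "HOL-Library.Landau_Symbols"
begin

section \<open>Finite signed Borel measures on the real line\<close>

text \<open>
  A finite signed measure is rendered as a real-valued set function. Requiring the value 0 off
  the Borel sets (as \<^const>\<open>measure\<close> does) makes equality of signed measures equality
  of functions, so that \<^term>\<open>stieltjes_measure\<close> below is determined by its
  distribution function. The value 0 on the empty set follows from countable additivity.
\<close>

definition finite_signed_measure :: "(real set \<Rightarrow> real) \<Rightarrow> bool" where
  "finite_signed_measure \<nu> \<longleftrightarrow>
     (\<forall>A. A \<notin> sets borel \<longrightarrow> \<nu> A = 0) \<and>
     (\<forall>A :: nat \<Rightarrow> real set. range A \<subseteq> sets borel \<longrightarrow> disjoint_family A \<longrightarrow>
        (\<lambda>i. \<nu> (A i)) sums \<nu> (\<Union>i. A i))"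

definition signed_cdf :: "(real set \<Rightarrow> real) \<Rightarrow> real \<Rightarrow> real" where
  "signed_cdf \<nu> \<xi> = \<nu> {..\<xi>}"

text \<open>
  The Jordan decomposition of \<open>\<nu>\<close> consists of the upper variations of \<open>\<nu>\<close> and
  of \<open>-\<nu>\<close>. Negative values of \<open>\<nu>\<close> are cut to 0 by \<^const>\<open>ennreal\<close>, which is
  harmless because the empty set takes part in the supremum.
\<close>

definition upper_variation :: "(real set \<Rightarrow> real) \<Rightarrow> real measure" where
  "upper_variation \<nu> =
     measure_of UNIV (sets borel) (\<lambda>A. \<Squnion>B\<in>{B \<in> sets borel. B \<subseteq> A}. ennreal (\<nu> B))"

definition signed_integral :: "(real set \<Rightarrow> real) \<Rightarrow> (real \<Rightarrow> real) \<Rightarrow> real" where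
  "signed_integral \<nu> f =
     (\<integral>x. f x \<partial>upper_variation \<nu>) - (\<integral>x. f x \<partial>upper_variation (\<lambda>A. - \<nu> A))"

definition signed_convolution ::
  "(real set \<Rightarrow> real) \<Rightarrow> (real set \<Rightarrow> real) \<Rightarrow> real set \<Rightarrow> real" where
  "signed_convolution \<nu> \<rho> A = signed_integral \<nu> (\<lambda>x. \<rho> {y. x + y \<in> A})"

primrec signed_conv_power :: "(real set \<Rightarrow> real) \<Rightarrow> nat \<Rightarrow> real set \<Rightarrow> real" where
  "signed_conv_power \<nu> 0 = measure (return borel 0)"
| "signed_conv_power \<nu> (Suc k) = signed_convolution \<nu> (signed_conv_power \<nu> k)"

text \<open>
  Integration \<open>\<integral> f(x) G(dx)\<close> against a function \<open>G\<close> of bounded variation is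
  integration against the signed measure with distribution function \<open>G\<close>.
\<close>

definition stieltjes_measure :: "(real \<Rightarrow> real) \<Rightarrow> real set \<Rightarrow> real" where
  "stieltjes_measure G = (THE \<nu>. finite_signed_measure \<nu> \<and> signed_cdf \<nu> = G)"

definition stieltjes_integral :: "(real \<Rightarrow> real) \<Rightarrow> (real \<Rightarrow> real) \<Rightarrow> real" where
  "stieltjes_integral G f = signed_integral (stieltjes_measure G) f"


section \<open>Probability measures: densities, zeros of the characteristic function, symmetrization\<close>

definition has_lebesgue_density :: "real measure \<Rightarrow> (real \<Rightarrow> real) \<Rightarrow> bool" where
  "has_lebesgue_density M f \<longleftrightarrow>
     f \<in> borel_measurable borel \<and> (AE x in lborel. 0 \<le> f x) \<and>
     M = density lborel (\<lambda>x. ennreal (f x))"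

definition char_zeros :: "real measure \<Rightarrow> ereal set" where
  "char_zeros M =
     {ereal t | t. char M t = 0} \<union>
     {t. t = \<infinity> \<and> (char M \<longlongrightarrow> 0) at_top} \<union>
     {t. t = - \<infinity> \<and> (char M \<longlongrightarrow> 0) at_bot}"

definition symmetrization :: "real measure \<Rightarrow> real measure \<Rightarrow> bool" where
  "symmetrization \<mu> \<mu>s \<longleftrightarrow>
     real_distribution \<mu>s \<and>
     (\<exists>\<eta>. real_distribution \<eta> \<and> \<mu>s = convolution \<mu> \<eta> \<and>
          (\<forall>t. char \<mu>s t = char \<mu> t * char \<eta> t)) \<and>
     (\<forall>\<xi>. (cdf \<mu>s \<longlongrightarrow> 1 - cdf \<mu>s (- \<xi>)) (at_left \<xi>)) \<and>
     (\<forall>t. char \<mu>s (- t) = char \<mu>s t) \<and>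
     (\<forall>t. \<exists>r\<in>{0..1}. char \<mu>s t = complex_of_real r) \<and>
     char_zeros \<mu>s = char_zeros \<mu>"


section \<open>The deconvolution density\<close>

definition dirac_minus :: "real measure \<Rightarrow> real set \<Rightarrow> real" where
  "dirac_minus \<mu>s A = measure (return borel 0) A - measure \<mu>s A"

definition deconv_kernel :: "real measure \<Rightarrow> real \<Rightarrow> nat \<Rightarrow> real" where
  "deconv_kernel \<mu>s \<xi> m = (\<Sum>l\<le>m. signed_cdf (signed_conv_power (dirac_minus \<mu>s) l) \<xi>)"

text \<open>
  The argument \<open>g\<close> is the density of \<open>\<chi> \<star> \<mu>s\<close>; it is passed as
  a function because the value of the integral at a point may depend on the chosen version.
\<close>

definition deconv_density :: "(real \<Rightarrow> real) \<Rightarrow> real measure \<Rightarrow> real \<Rightarrow> nat \<Rightarrow> real" where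
  "deconv_density g \<mu>s \<xi> m =
     stieltjes_integral (\<lambda>x. deconv_kernel \<mu>s x m) (\<lambda>x. g (\<xi> - x))"

definition Linf_norm :: "(real \<Rightarrow> real) \<Rightarrow> ereal" where
  "Linf_norm f = esssup lborel (\<lambda>x. ereal \<bar>f x\<bar>)"

end

theory Submission
  imports Defs
begin

text \<open>
  Let \<open>\<phi>\<close> be the characteristic function of \<open>\<chi>\<close>, and \<open>s\<close> that of the symmetrization of \<open>\<mu>\<close>,
  which takes values in \<open>[0, 1]\<close>. The transform of the kernel with index \<open>m\<close> is the geometric sum
  \<open>\<Sum>l\<le>m. (1 - s) ^ l\<close>, and that of \<open>g\<close> is \<open>\<phi> * s\<close>. The deconvolution density is their convolution, so
  its transform is \<open>\<phi> * (1 - (1 - s) ^ Suc m)\<close>, and the error is, up to sign and almost everywhere,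
  the inverse transform of \<open>\<phi> * (1 - s) ^ Suc m\<close>. Because \<open>0 \<le> 1 - s \<le> 1\<close>, the powers decrease
  pointwise to the indicator of the zero set of \<open>s\<close>. An inverse transform is bounded by the \<open>L\<^sup>1\<close> norm
  of its argument over \<open>2 \<pi>\<close>, so dominated convergence with majorant \<open>|\<phi>|\<close> makes the errors
  converge uniformly, to the inverse transform of \<open>\<phi>\<close> restricted to that zero set. The limit of the
  norms is the norm of this function; it vanishes if \<open>\<phi> = 0\<close> almost everywhere on the zero set,
  which \<open>s\<close> shares with the characteristic function of \<open>\<mu>\<close>.

  Three ingredients justify this computation. By \<open>signed_integral_sum\<close>, the integral against a finite
  linear combination of finite measures, although defined through the Jordan decomposition, is the
  linear combination of the integrals; together with \<open>signed_measure_eqI_cdf\<close> this turns the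
  deconvolution density into a binomial sum of ordinary integrals against convolution powers
  (\<open>deconv_density_eq_sum\<close>). By \<open>density_eq_inv_fourier\<close>, the density of a distribution with integrable
  characteristic function is its inverse transform almost everywhere, and everywhere if the density is
  continuous, as \<open>g\<close> is. Finally, \<open>tendsto_Linf_norm_inv_fourier_power\<close> contains the passage to the
  limit.
\<close>

section \<open>Bounded signed measures\<close>

lemma signed_measure_empty:
  assumes "finite_signed_measure \<nu>" shows "\<nu> {} = 0"
proof -
  have "(\<lambda>i::nat. \<nu> ((\<lambda>_. {}) i)) sums \<nu> (\<Union>i::nat. (\<lambda>_. {}) i)"
    using assms unfolding finite_signed_measure_def by (auto simp: disjoint_family_on_def)
  then have "summable (\<lambda>i::nat. \<nu> {})" by (auto simp: sums_iff)
  then show ?thesis by (simp add: summable_const_iff)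
qed

lemma signed_measure_Un:
  assumes \<nu>: "finite_signed_measure \<nu>" and [measurable]: "A \<in> sets borel" "B \<in> sets borel"
    and "A \<inter> B = {}"
  shows "\<nu> (A \<union> B) = \<nu> A + \<nu> B"
proof -
  have "range (binaryset A B) \<subseteq> sets borel" "disjoint_family (binaryset A B)"
    using assms by (auto simp: range_binaryset_eq disjoint_family_on_def binaryset_def)
  then have "(\<lambda>i. \<nu> (binaryset A B i)) sums \<nu> (A \<union> B)"
    using \<nu> unfolding finite_signed_measure_def by (metis UN_binaryset_eq)
  with binaryset_sums[of \<nu> A B] signed_measure_empty[OF \<nu>] show ?thesis
    using sums_unique2 by blast
qed

lemma signed_measure_Diff:
  assumes \<nu>: "finite_signed_measure \<nu>" and [measurable]: "A \<in> sets borel" "B \<in> sets borel"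
    and "B \<subseteq> A"
  shows "\<nu> (A - B) = \<nu> A - \<nu> B"
  using signed_measure_Un[OF \<nu>, of "A - B" B] assms by (simp add: Un_absorb2 Diff_disjoint[of B A] Int_commute)

lemma finite_signed_measure_uminus:
  "finite_signed_measure \<nu> \<Longrightarrow> finite_signed_measure (\<lambda>A. - \<nu> A)"
  unfolding finite_signed_measure_def by (auto intro!: sums_minus)

text \<open>
  The closed half-lines form an intersection-stable generator of the Borel sets, so the claim follows
  by the \<open>\<pi>\<close>-\<open>\<lambda>\<close> argument. The total masses, needed for complements, agree because the line is a
  disjoint union of one half-line and countably many half-open intervals.
\<close>

lemma signed_measure_eqI_cdf:
  assumes \<nu>: "finite_signed_measure \<nu>" and \<rho>: "finite_signed_measure \<rho>"
    and cdf: "signed_cdf \<nu> = signed_cdf \<rho>"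
  shows "\<nu> = \<rho>"
proof
  fix A
  have Iic: "\<nu> {..a} = \<rho> {..a}" for a
    using fun_cong[OF cdf, of a] by (simp add: signed_cdf_def)
  have additive: "(\<lambda>i. \<kappa> (D i)) sums \<kappa> (\<Union>i. D i)"
    if "finite_signed_measure \<kappa>" "range D \<subseteq> sets borel" "disjoint_family D"
    for \<kappa> and D :: "nat \<Rightarrow> real set"
    using that unfolding finite_signed_measure_def by blast
  define D where "D = disjointed (\<lambda>n. {..real n})"
  have D: "range D \<subseteq> sets borel" "disjoint_family D" "(\<Union>i. D i) = UNIV"
    unfolding D_def UN_disjointed_eq
    by (auto simp: disjoint_family_disjointed disjointed_def real_arch_simple)
  have "\<nu> (D n) = \<rho> (D n)" for n
  proof (cases n)
    case 0 then show ?thesis by (simp add: D_def disjointed_def Iic)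
  next
    case (Suc k)
    have "D n = {..real n} - {..real k}"
      unfolding D_def Suc by (subst disjointed_mono) (auto simp: mono_def)
    then show ?thesis
      using Suc by (simp add: signed_measure_Diff[OF \<nu>] signed_measure_Diff[OF \<rho>] Iic)
  qed
  then have UNIV: "\<nu> UNIV = \<rho> UNIV"
    using additive[OF \<nu> D(1,2)] additive[OF \<rho> D(1,2)] D(3) by (simp add: sums_iff)
  show "\<nu> A = \<rho> A"
  proof (cases "A \<in> sets borel")
    case True
    have "Int_stable (range (\<lambda>a::real. {..a}))"
      by (auto simp: Int_stable_def)
    moreover have "range (\<lambda>a::real. {..a}) \<subseteq> Pow UNIV" by simp
    moreover have "A \<in> sigma_sets UNIV (range (\<lambda>a::real. {..a}))"
      using True by (subst (asm) borel_eq_atMost) simp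
    ultimately show ?thesis
    proof (induction rule: sigma_sets_induct_disjoint)
      case (basic A) then show ?case using Iic by auto
    next
      case empty
      then show ?case by (simp add: signed_measure_empty[OF \<nu>] signed_measure_empty[OF \<rho>])
    next
      case (compl A)
      then have "A \<in> sets borel" by (subst borel_eq_atMost) simp
      with compl show ?case
        by (simp add: signed_measure_Diff[OF \<nu>] signed_measure_Diff[OF \<rho>] UNIV)
    next
      case (union A)
      then have "range A \<subseteq> sets borel" by (subst borel_eq_atMost) simp
      with additive[OF \<nu> this] additive[OF \<rho> this] union show ?case by (simp add: sums_iff)
    qed
  next
    case False then show ?thesis using \<nu> \<rho> by (auto simp: finite_signed_measure_def)
  qed
qed

lemma stieltjes_measure_signed_cdf:
  "finite_signed_measure \<nu> \<Longrightarrow> stieltjes_measure (signed_cdf \<nu>) = \<nu>"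
  unfolding stieltjes_measure_def by (rule the_equality) (auto intro: signed_measure_eqI_cdf)

lemma ennreal_le_suminf:
  assumes "f sums x" shows "ennreal x \<le> (\<Sum>i. ennreal (f i))"
proof (rule LIMSEQ_le_const2)
  show "(\<lambda>n. ennreal (\<Sum>i<n. f i)) \<longlonglongrightarrow> ennreal x"
    using assms by (auto simp: sums_def intro: tendsto_ennrealI)
  have sub: "ennreal (\<Sum>i<n. f i) \<le> (\<Sum>i<n. ennreal (f i))" for n
  proof (induction n)
    case (Suc n)
    have "ennreal (\<Sum>i<Suc n. f i) \<le> ennreal (\<Sum>i<n. f i) + ennreal (f n)"
      by (cases "(\<Sum>i<n. f i) \<ge> 0"; cases "f n \<ge> 0")
         (auto simp flip: ennreal_plus intro!: ennreal_leI simp: ennreal_neg )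
    with Suc show ?case by (simp add: add_mono order_trans)
  qed simp
  have "(\<Sum>i<n. ennreal (f i)) \<le> (\<Sum>i. ennreal (f i))" for n
    by (rule sum_le_suminf) auto
  with sub show "\<exists>N. \<forall>n\<ge>N. ennreal (\<Sum>i<n. f i) \<le> (\<Sum>i. ennreal (f i))"
    using order_trans by blast
qed

text \<open>
  The upper variation is a measure: it is superadditive on disjoint sets because subsets of the two
  parts with positive values can be united, and countably subadditive because a subset of a disjoint
  union splits along the parts.
\<close>

lemma
  assumes \<nu>: "finite_signed_measure \<nu>"
  shows sets_upper_variation: "sets (upper_variation \<nu>) = sets borel"
    and emeasure_upper_variation:
      "A \<in> sets borel \<Longrightarrow>
         emeasure (upper_variation \<nu>) A = (\<Squnion>B\<in>{B \<in> sets borel. B \<subseteq> A}. ennreal (\<nu> B))"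
proof -
  show sets: "sets (upper_variation \<nu>) = sets borel"
    using sets.sigma_sets_eq[of "borel :: real measure"] by (simp add: upper_variation_def)
  let ?U = "\<lambda>A. \<Squnion>B\<in>{B \<in> sets borel. B \<subseteq> A}. ennreal (\<nu> B)"
  have mono: "?U A \<le> ?U B" if "A \<subseteq> B" for A B
    using that by (intro SUP_subset_mono) auto
  have super: "?U A + ?U B \<le> ?U (A \<union> B)" if "A \<inter> B = {}" for A B
  proof -
    have "ennreal (\<nu> C) + ennreal (\<nu> D) \<le> ?U (A \<union> B)"
      if "C \<in> {B \<in> sets borel. B \<subseteq> A}" "D \<in> {C \<in> sets borel. C \<subseteq> B}" for C D
    proof -
      have disj: "C \<inter> D = {}" using that \<open>A \<inter> B = {}\<close> by auto
      have le: "ennreal (\<nu> E) \<le> ?U (A \<union> B)" if "E \<in> sets borel" "E \<subseteq> A \<union> B" for E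
        using that by (intro SUP_upper) auto
      show ?thesis
      proof (cases "0 \<le> \<nu> C \<and> 0 \<le> \<nu> D")
        case True
        then have "ennreal (\<nu> C) + ennreal (\<nu> D) = ennreal (\<nu> (C \<union> D))"
          using that disj by (simp add: signed_measure_Un[OF \<nu>])
        with le[of "C \<union> D"] that show ?thesis by auto
      next
        case False
        moreover have "C \<subseteq> A \<union> B" "D \<subseteq> A \<union> B" using that by auto
        ultimately show ?thesis using le[of C] le[of D] that by (auto simp: ennreal_neg)
      qed
    qed
    moreover have ne: "{C \<in> sets borel. C \<subseteq> E} \<noteq> {}" for E :: "real set" by auto
    ultimately have "ennreal (\<nu> C) + ?U B \<le> ?U (A \<union> B)" if "C \<in> {B \<in> sets borel. B \<subseteq> A}" for C
      unfolding ennreal_SUP_add_right[OF ne] using that by (intro SUP_least) blast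
    then show ?thesis
      unfolding ennreal_SUP_add_left[OF ne, symmetric] by (intro SUP_least) blast
  qed
  have U_empty: "?U {} = 0"
  proof -
    have "{B \<in> sets borel. B \<subseteq> {}} = {{} :: real set}" by auto
    then show ?thesis by (simp add: signed_measure_empty[OF \<nu>])
  qed
  have "countably_additive (sets borel) ?U"
    unfolding countably_additive_def
  proof (intro allI impI antisym)
    fix A :: "nat \<Rightarrow> real set"
    assume A: "range A \<subseteq> sets borel" "disjoint_family A" "\<Union> (range A) \<in> sets borel"
    have fin: "(\<Sum>i<n. ?U (A i)) \<le> ?U (\<Union>i<n. A i)" for n
    proof (induction n)
      case (Suc n)
      have "A i \<inter> A n = {}" if "i < n" for i
        using disjoint_family_onD[OF A(2), of i n] that by simp
      then have disj: "(\<Union>i<n. A i) \<inter> A n = {}" by blast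
      have "(\<Sum>i<Suc n. ?U (A i)) \<le> ?U (\<Union>i<n. A i) + ?U (A n)"
        using Suc by (simp add: add_mono)
      also have "\<dots> \<le> ?U ((\<Union>i<n. A i) \<union> A n)"
        by (rule super[OF disj])
      finally show ?case by (simp add: lessThan_Suc Un_commute)
    qed (use U_empty in simp)
    have "(\<Sum>i<n. ?U (A i)) \<le> ?U (\<Union> (range A))" for n
      by (rule order_trans[OF fin mono]) auto
    then show "(\<Sum>i. ?U (A i)) \<le> ?U (\<Union> (range A))"
      by (intro suminf_le_const) auto
    show "?U (\<Union> (range A)) \<le> (\<Sum>i. ?U (A i))"
    proof (rule SUP_least)
      fix B assume B: "B \<in> {B \<in> sets borel. B \<subseteq> \<Union> (range A)}"
      have "(\<lambda>i. \<nu> (B \<inter> A i)) sums \<nu> (\<Union>i. B \<inter> A i)"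
        using \<nu> A B unfolding finite_signed_measure_def
        by (elim conjE allE[of _ "\<lambda>i. B \<inter> A i"]) (auto simp: disjoint_family_on_def)
      moreover have "(\<Union>i. B \<inter> A i) = B" using B by auto
      ultimately have "ennreal (\<nu> B) \<le> (\<Sum>i. ennreal (\<nu> (B \<inter> A i)))"
        by (intro ennreal_le_suminf) simp
      also have "\<dots> \<le> (\<Sum>i. ?U (A i))"
        using A B by (intro suminf_le SUP_upper) auto
      finally show "ennreal (\<nu> B) \<le> (\<Sum>i. ?U (A i))" .
    qed
  qed
  then show "emeasure (upper_variation \<nu>) A = ?U A" if "A \<in> sets borel"
    using that sets U_empty
    by (intro emeasure_measure_of[OF upper_variation_def]) (auto simp: positive_def)
qed

lemma finite_measure_upper_variation:
  assumes \<nu>: "finite_signed_measure \<nu>" and bounded: "\<And>B. \<bar>\<nu> B\<bar> \<le> K"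
  shows "finite_measure (upper_variation \<nu>)"
proof
  have "space (upper_variation \<nu>) = UNIV"
    using sets_eq_imp_space_eq[OF sets_upper_variation[OF \<nu>]] by simp
  moreover have "emeasure (upper_variation \<nu>) UNIV \<le> ennreal K"
    using bounded by (subst emeasure_upper_variation[OF \<nu>]) (auto intro!: SUP_least ennreal_leI order_trans[OF abs_ge_self bounded])
  ultimately show "emeasure (upper_variation \<nu>) (space (upper_variation \<nu>)) \<noteq> \<infinity>"
    by (auto simp: top_unique)
qed

lemma le_measure_upper_variation:
  assumes \<nu>: "finite_signed_measure \<nu>" and bounded: "\<And>B. \<bar>\<nu> B\<bar> \<le> K"
    and "B \<in> sets borel" "B \<subseteq> A" "A \<in> sets borel"
  shows "\<nu> B \<le> measure (upper_variation \<nu>) A"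
proof -
  interpret finite_measure "upper_variation \<nu>" by (rule finite_measure_upper_variation[OF \<nu> bounded])
  have "ennreal (\<nu> B) \<le> emeasure (upper_variation \<nu>) A"
    using assms(3-) by (subst emeasure_upper_variation[OF \<nu>]) (auto intro: SUP_upper)
  then show ?thesis by (simp add: emeasure_eq_measure)
qed

text \<open>
  For \<open>B \<subseteq> A\<close>, the identity \<open>\<nu> B = \<nu> A - \<nu> (A - B)\<close> bounds \<open>\<nu> B\<close> by \<open>\<nu> A\<close> plus the upper variation
  of \<open>-\<nu>\<close> on \<open>A\<close>. Applied to \<open>\<nu>\<close> and to \<open>-\<nu>\<close>, the inequality gives the Jordan decomposition
  without a Hahn set.
\<close>

lemma Jordan_decomposition_le:
  assumes \<nu>: "finite_signed_measure \<nu>" and bounded: "\<And>B. \<bar>\<nu> B\<bar> \<le> K"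
    and A: "A \<in> sets borel"
  shows "measure (upper_variation \<nu>) A \<le> \<nu> A + measure (upper_variation (\<lambda>A. - \<nu> A)) A"
proof -
  interpret finite_measure "upper_variation \<nu>" by (rule finite_measure_upper_variation[OF \<nu> bounded])
  have *: "\<nu> B \<le> \<nu> A + measure (upper_variation (\<lambda>A. - \<nu> A)) A" if "B \<in> sets borel" "B \<subseteq> A" for B
    using le_measure_upper_variation[of "\<lambda>A. - \<nu> A" K "A - B" A] finite_signed_measure_uminus[OF \<nu>]
      bounded A that by (simp add: signed_measure_Diff[OF \<nu>])
  have "emeasure (upper_variation \<nu>) A \<le> ennreal (\<nu> A + measure (upper_variation (\<lambda>A. - \<nu> A)) A)"
    using * A by (subst emeasure_upper_variation[OF \<nu>]) (auto intro!: SUP_least ennreal_leI)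
  moreover have "0 \<le> \<nu> A + measure (upper_variation (\<lambda>A. - \<nu> A)) A"
    using *[of "{}"] signed_measure_empty[OF \<nu>] by simp
  ultimately show ?thesis by (simp add: emeasure_eq_measure)
qed

lemma Jordan_decomposition:
  assumes \<nu>: "finite_signed_measure \<nu>" and bounded: "\<And>B. \<bar>\<nu> B\<bar> \<le> K"
    and A: "A \<in> sets borel"
  shows "measure (upper_variation \<nu>) A - measure (upper_variation (\<lambda>A. - \<nu> A)) A = \<nu> A"
  using Jordan_decomposition_le[OF \<nu> bounded A]
    Jordan_decomposition_le[of "\<lambda>A. - \<nu> A" K A] finite_signed_measure_uminus[OF \<nu>] bounded A
  by simp

text \<open>
  Since the coefficients may have either sign, monotone convergence does not suffice; the induction
  runs over nonnegative bounded functions, where dominated convergence handles the limits. Adding a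
  constant reduces the general case to this one.
\<close>

lemma integral_linear_relation:
  fixes M :: "'i \<Rightarrow> real measure"
  assumes I: "finite I" and M: "\<And>i. i \<in> I \<Longrightarrow> finite_measure (M i)"
    and sets: "\<And>i. i \<in> I \<Longrightarrow> sets (M i) = sets borel"
    and rel: "\<And>A. A \<in> sets borel \<Longrightarrow> (\<Sum>i\<in>I. c i * measure (M i) A) = 0"
    and f[measurable]: "f \<in> borel_measurable borel" and bdd: "\<And>x. \<bar>f x\<bar> \<le> C"
  shows "(\<Sum>i\<in>I. c i * (\<integral>x. f x \<partial>M i)) = (0::real)"
proof -
  have meas: "u \<in> borel_measurable (M i)" if "u \<in> borel_measurable borel" "i \<in> I" for u :: "real \<Rightarrow> real" and i
    using that(1) by (simp add: measurable_cong_sets[OF sets[OF that(2)] refl])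
  have int: "integrable (M i) u"
    if "u \<in> borel_measurable borel" "\<And>x. \<bar>u x\<bar> \<le> D" "i \<in> I" for u :: "real \<Rightarrow> real" and D i
    by (rule finite_measure.integrable_const_bound[OF M[OF that(3)], of _ D])
      (simp_all add: that meas)
  have nonneg: "\<forall>D. (\<forall>x. u x \<le> D) \<longrightarrow> (\<Sum>i\<in>I. c i * (\<integral>x. u x \<partial>M i)) = 0"
    if "u \<in> borel_measurable borel" "\<And>x. 0 \<le> u x" for u
    using that
  proof (induction u rule: borel_measurable_induct_real)
    case (set A)
    then have "(\<integral>x. indicator A x \<partial>M i) = measure (M i) A" if "i \<in> I" for i
      using that sets[OF that] sets_eq_imp_space_eq[OF sets[OF that]] by simp
    with rel[OF set] show ?case by simp
  next
    case (mult u d)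
    show ?case
    proof (intro allI impI)
      fix D assume D: "\<forall>x. d * u x \<le> D"
      show "(\<Sum>i\<in>I. c i * (\<integral>x. d * u x \<partial>M i)) = 0"
      proof (cases "d = 0")
        case False
        then have "\<forall>x. u x \<le> D / d" using D mult by (simp add: field_simps)
        with mult have "d * (\<Sum>i\<in>I. c i * (\<integral>x. u x \<partial>M i)) = 0" by auto
        then show ?thesis by (simp add: sum_distrib_left ac_simps)
      qed simp
    qed
  next
    case (add u v)
    show ?case
    proof (intro allI impI)
      fix D assume D: "\<forall>x. v x + u x \<le> D"
      have u: "u x \<le> D" and v: "v x \<le> D" for x
        using D[rule_format, of x] add.hyps(2)[of x] add.hyps(4)[of x] by linarith+
      have "(\<integral>x. v x + u x \<partial>M i) = (\<integral>x. v x \<partial>M i) + (\<integral>x. u x \<partial>M i)" if "i \<in> I" for i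
        using add u v that by (intro Bochner_Integration.integral_add int[where D=D]) auto
      moreover have "(\<Sum>i\<in>I. c i * (\<integral>x. u x \<partial>M i)) = 0" "(\<Sum>i\<in>I. c i * (\<integral>x. v x \<partial>M i)) = 0"
        using add.IH u v by blast+
      ultimately show "(\<Sum>i\<in>I. c i * (\<integral>x. v x + u x \<partial>M i)) = 0"
        by (simp add: distrib_left sum.distrib)
    qed
  next
    case (seq U)
    show ?case
    proof (intro allI impI)
      fix D assume D: "\<forall>x. u x \<le> D"
      have le: "U k x \<le> D" for k x
      proof -
        have "incseq (\<lambda>k. U k x)"
          using seq.hyps(3) by (auto simp: incseq_def le_fun_def)
        then have "U k x \<le> u x" using seq.hyps(4)[of x] by (intro incseq_le) simp_all
        then show ?thesis using D[rule_format, of x] by linarith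
      qed
      have u: "u \<in> borel_measurable borel"
        by (rule borel_measurable_LIMSEQ_real[of borel U]) (use seq.hyps in simp_all)
      have "(\<lambda>k. \<integral>x. U k x \<partial>M i) \<longlonglongrightarrow> (\<integral>x. u x \<partial>M i)" if "i \<in> I" for i
      proof (rule integral_dominated_convergence[where w="\<lambda>_. D"])
        show "AE x in M i. norm (U k x) \<le> D" for k
          using seq.hyps(2) le by simp
        show "integrable (M i) (\<lambda>_. D)" using M[OF that] by (simp add: finite_measure.integrable_const)
        show "AE x in M i. (\<lambda>k. U k x) \<longlonglongrightarrow> u x" using seq.hyps(4) by simp
      qed (use that seq.hyps(1) u in \<open>simp_all add: meas\<close>)
      then have "(\<lambda>k. \<Sum>i\<in>I. c i * (\<integral>x. U k x \<partial>M i)) \<longlonglongrightarrow> (\<Sum>i\<in>I. c i * (\<integral>x. u x \<partial>M i))"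
        by (intro tendsto_intros)
      moreover have "(\<Sum>i\<in>I. c i * (\<integral>x. U k x \<partial>M i)) = 0" for k
        using seq.IH[of k] le[of k] by blast
      ultimately show "(\<Sum>i\<in>I. c i * (\<integral>x. u x \<partial>M i)) = 0"
        by (simp add: LIMSEQ_const_iff)
    qed
  qed
  have C: "0 \<le> C" using bdd[of 0] by linarith
  have "0 \<le> f x + C" "f x + C \<le> 2 * C" for x using bdd[of x] by linarith+
  then have "(\<Sum>i\<in>I. c i * (\<integral>x. f x + C \<partial>M i)) = 0"
    by (intro nonneg[rule_format, of _ "2 * C"]) simp_all
  moreover have "(\<Sum>i\<in>I. c i * (\<integral>x. C \<partial>M i)) = 0"
    using C by (intro nonneg[rule_format, of _ C]) simp_all
  moreover have "(\<integral>x. f x + C \<partial>M i) = (\<integral>x. f x \<partial>M i) + (\<integral>x. C \<partial>M i)" if "i \<in> I" for i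
    using that bdd C by (intro Bochner_Integration.integral_add int[where D=C] f) simp_all
  ultimately show ?thesis by (simp add: distrib_left sum.distrib)
qed

text \<open>
  The two measures of the Jordan decomposition and the given family satisfy a linear relation on
  Borel sets, hence so do the integrals against them.
\<close>

lemma
  fixes M :: "'i \<Rightarrow> real measure"
  assumes I: "finite I" and M: "\<And>i. i \<in> I \<Longrightarrow> finite_measure (M i)"
    and sets: "\<And>i. i \<in> I \<Longrightarrow> sets (M i) = sets borel"
  shows finite_signed_measure_sum: "finite_signed_measure (\<lambda>A. \<Sum>i\<in>I. c i * measure (M i) A)"
    and signed_integral_sum: "f \<in> borel_measurable borel \<Longrightarrow> (\<And>x. \<bar>f x\<bar> \<le> C) \<Longrightarrow>
      signed_integral (\<lambda>A. \<Sum>i\<in>I. c i * measure (M i) A) f = (\<Sum>i\<in>I. c i * (\<integral>x. f x \<partial>M i))"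
proof -
  let ?\<nu> = "\<lambda>A. \<Sum>i\<in>I. c i * measure (M i) A"
  show fsm: "finite_signed_measure ?\<nu>"
    unfolding finite_signed_measure_def
  proof (intro conjI allI impI)
    fix A :: "real set" assume "A \<notin> sets borel"
    then show "?\<nu> A = 0" using sets by (auto intro!: sum.neutral simp: measure_notin_sets)
  next
    fix A :: "nat \<Rightarrow> real set" assume A: "range A \<subseteq> sets borel" "disjoint_family A"
    then have "(\<lambda>n. measure (M i) (A n)) sums measure (M i) (\<Union>n. A n)" if "i \<in> I" for i
      using that M sets by (intro finite_measure.finite_measure_UNION) auto
    then show "(\<lambda>n. ?\<nu> (A n)) sums ?\<nu> (\<Union>n. A n)"
      by (intro sums_sum sums_mult)
  qed
  assume f: "f \<in> borel_measurable borel" "\<And>x. \<bar>f x\<bar> \<le> C"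
  define K where "K = (\<Sum>i\<in>I. \<bar>c i\<bar> * measure (M i) UNIV)"
  have bounded: "\<bar>?\<nu> B\<bar> \<le> K" for B
  proof -
    have "measure (M i) B \<le> measure (M i) UNIV" if "i \<in> I" for i
      using finite_measure.bounded_measure[OF M[OF that], of B]
        sets_eq_imp_space_eq[OF sets[OF that]] by simp
    then show ?thesis unfolding K_def
      by (intro order_trans[OF sum_abs] sum_mono) (auto simp: abs_mult intro: mult_left_mono)
  qed
  \<comment> \<open>one family for the relation: the given measures on the left, the Jordan decomposition on the right\<close>
  define N where "N = case_sum M (\<lambda>b. if b then upper_variation ?\<nu> else upper_variation (\<lambda>A. - ?\<nu> A))"
  define d where "d = case_sum c (\<lambda>b. if b then - 1 else 1 :: real)"
  note uminus = finite_signed_measure_uminus[OF fsm]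
  have "(\<Sum>i\<in>I <+> {True, False}. d i * (\<integral>x. f x \<partial>N i)) = 0"
  proof (rule integral_linear_relation[OF _ _ _ _ f])
    show "finite_measure (N i)" "sets (N i) = sets borel" if "i \<in> I <+> {True, False}" for i
      using that M sets finite_measure_upper_variation[OF fsm bounded]
        finite_measure_upper_variation[OF uminus, of K] bounded
        sets_upper_variation[OF fsm] sets_upper_variation[OF uminus]
      by (auto simp: N_def)
    show "(\<Sum>i\<in>I <+> {True, False}. d i * measure (N i) A) = 0" if "A \<in> sets borel" for A
      using Jordan_decomposition[OF fsm bounded that] I by (simp add: sum.Plus N_def d_def)
  qed (use I in auto)
  then show "signed_integral ?\<nu> f = (\<Sum>i\<in>I. c i * (\<integral>x. f x \<partial>M i))"
    using I by (simp add: sum.Plus N_def d_def signed_integral_def)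
qed

section \<open>Convolution powers\<close>

primrec conv_power :: "real measure \<Rightarrow> nat \<Rightarrow> real measure" where
  "conv_power M 0 = return borel 0"
| "conv_power M (Suc k) = convolution M (conv_power M k)"

lemma real_distribution_convolution:
  assumes "real_distribution M" "real_distribution N"
  shows "real_distribution (convolution M N)"
proof -
  interpret M: real_distribution M by fact
  interpret N: real_distribution N by fact
  interpret pair_prob_space M N ..
  show ?thesis
    unfolding convolution_def by (intro real_distribution_distr) simp
qed

lemma real_distribution_conv_power:
  assumes "real_distribution M" shows "real_distribution (conv_power M k)"
proof (induction k)
  case 0
  have "prob_space (return borel (0::real))" by (rule prob_space_return) simp
  then show ?case
    unfolding conv_power.simps real_distribution_def real_distribution_axioms_def by simp
next
  case (Suc k)
  then show ?case
    unfolding conv_power.simps by (rule real_distribution_convolution[OF assms])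
qed

lemma char_convolution:
  assumes "real_distribution M" "real_distribution N"
  shows "char (convolution M N) t = char M t * char N t"
proof -
  interpret M: real_distribution M by fact
  interpret N: real_distribution N by fact
  interpret P: pair_prob_space M N ..
  have int: "integrable (M \<Otimes>\<^sub>M N) (\<lambda>(x, y). iexp (t * x) * iexp (t * y))"
    by (intro P.integrable_const_bound[where B=1]) (auto simp: norm_mult)
  have "char (convolution M N) t = (\<integral>z. (case z of (x, y) \<Rightarrow> iexp (t * x) * iexp (t * y)) \<partial>(M \<Otimes>\<^sub>M N))"
    unfolding char_def convolution_def
    by (subst integral_distr) (auto simp: case_prod_beta' distrib_left exp_add)
  also have "\<dots> = (\<integral>x. (\<integral>y. iexp (t * x) * iexp (t * y) \<partial>N) \<partial>M)"
    using P.integral_fst'[OF int] by simp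
  finally show ?thesis by (simp add: char_def)
qed

lemma char_conv_power:
  assumes "real_distribution M" shows "char (conv_power M k) t = char M t ^ k"
proof (induction k)
  case 0 show ?case unfolding char_def conv_power.simps by (subst integral_return) simp_all
next
  case (Suc k) then show ?case
    by (simp only: conv_power.simps char_convolution[OF assms real_distribution_conv_power[OF assms]] power_Suc)
qed

lemma measurable_measure_shift:
  assumes "real_distribution N" and A: "A \<in> sets borel"
  shows "(\<lambda>x. measure N {y. x + y \<in> A}) \<in> borel_measurable borel"
proof -
  interpret N: real_distribution N by fact
  let ?B = "borel :: real measure"
  have sets: "sets (?B \<Otimes>\<^sub>M N) = sets (?B \<Otimes>\<^sub>M ?B)"
    by (rule sets_pair_measure_cong[OF refl N.events_eq_borel])
  have "(\<lambda>p. fst p + snd p) \<in> borel_measurable (?B \<Otimes>\<^sub>M ?B)"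
    by (intro borel_measurable_add measurable_fst measurable_snd)
  then have "(\<lambda>p. fst p + snd p) \<in> borel_measurable (?B \<Otimes>\<^sub>M N)"
    unfolding measurable_cong_sets[OF sets refl] .
  from measurable_sets[OF this A]
  have S: "(\<lambda>p. fst p + snd p) -` A \<inter> space (?B \<Otimes>\<^sub>M N) \<in> sets (?B \<Otimes>\<^sub>M N)" .
  have "Pair x -` ((\<lambda>p. fst p + snd p) -` A \<inter> space (?B \<Otimes>\<^sub>M N)) = {y. x + y \<in> A}" for x
    by (auto simp: space_pair_measure)
  with N.measurable_emeasure_Pair[OF S]
  have "(\<lambda>x. emeasure N {y. x + y \<in> A}) \<in> borel_measurable borel" by simp
  then show ?thesis unfolding measure_def by (rule borel_measurable_enn2real)
qed

lemma measure_convolution: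
  assumes "real_distribution M" "real_distribution N" "A \<in> sets borel"
  shows "measure (convolution M N) A = (\<integral>x. measure N {y. x + y \<in> A} \<partial>M)"
proof -
  interpret M: real_distribution M by fact
  interpret N: real_distribution N by fact
  have [measurable]: "A \<in> sets borel" by fact
  have "emeasure (convolution M N) A = (\<integral>\<^sup>+x. emeasure N {y. y + x \<in> A} \<partial>M)"
    by (rule convolution_emeasure[OF assms(3) M.finite_measure_axioms N.finite_measure_axioms]) simp_all
  also have "\<dots> = (\<integral>\<^sup>+x. emeasure N {y. x + y \<in> A} \<partial>M)"
    by (simp only: add.commute)
  also have "\<dots> = (\<integral>\<^sup>+x. ennreal (measure N {y. x + y \<in> A}) \<partial>M)"
    by (simp add: N.emeasure_eq_measure)
  finally have "measure (convolution M N) A = enn2real (\<integral>\<^sup>+x. ennreal (measure N {y. x + y \<in> A}) \<partial>M)"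
    by (simp add: measure_def[of "convolution M N"])
  also have "\<dots> = (\<integral>x. measure N {y. x + y \<in> A} \<partial>M)"
    using measurable_measure_shift[OF assms(2,3)] by (subst integral_eq_nn_integral) simp_all
  finally show ?thesis .
qed

text \<open>
  Signed measures vanish off the Borel sets; this equivalence lets a convolution inherit that
  convention.
\<close>

lemma shift_in_borel_iff: "{y. x + y \<in> A} \<in> sets borel \<longleftrightarrow> A \<in> sets (borel :: real measure)"
proof
  assume S: "{y. x + y \<in> A} \<in> sets borel"
  have "(\<lambda>y. y - x) -` {y. x + y \<in> A} \<inter> space borel \<in> sets borel"
    by (rule measurable_sets[OF _ S]) simp
  moreover have "(\<lambda>y. y - x) -` {y. x + y \<in> A} \<inter> space borel = A" by auto
  ultimately show "A \<in> sets borel" by simp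
next
  assume A: "A \<in> sets borel"
  have "(\<lambda>y. x + y) -` A \<inter> space borel \<in> sets borel"
    by (rule measurable_sets[OF _ A]) simp
  moreover have "(\<lambda>y. x + y) -` A \<inter> space borel = {y. x + y \<in> A}" by auto
  ultimately show "{y. x + y \<in> A} \<in> sets borel" by simp
qed

section \<open>The deconvolution kernel as a combination of convolution powers\<close>

text \<open>
  Summation by parts with Pascal's rule: multiplying \<open>(1 - X) ^ n\<close> by \<open>1 - X\<close>, where \<open>X\<close> acts as
  the shift \<open>a k \<mapsto> a (Suc k)\<close>.
\<close>

lemma alternating_binomial_step:
  fixes a :: "nat \<Rightarrow> real"
  shows "(\<Sum>k\<le>n. (-1)^k * (n choose k) * (a k - a (Suc k))) =
         (\<Sum>k\<le>Suc n. (-1)^k * (Suc n choose k) * a k)"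
proof -
  have "(\<Sum>k\<le>Suc n. (-1)^k * (Suc n choose k) * a k) =
    (-1)^0 * (Suc n choose 0) * a 0 + (\<Sum>k\<le>n. (-1)^Suc k * (Suc n choose Suc k) * a (Suc k))"
    by (rule sum.atMost_Suc_shift)
  also have "\<dots> =
    a 0 + (\<Sum>k\<le>n. (-1)^Suc k * (n choose Suc k) * a (Suc k)) - (\<Sum>k\<le>n. (-1)^k * (n choose k) * a (Suc k))"
    by (simp add: algebra_simps flip: sum.distrib sum_negf)
  also have "a 0 + (\<Sum>k\<le>n. (-1)^Suc k * (n choose Suc k) * a (Suc k)) =
    (\<Sum>k\<le>Suc n. (-1)^k * (n choose k) * a k)"
    unfolding sum.atMost_Suc_shift[of _ n] by simp
  also have "\<dots> = (\<Sum>k\<le>n. (-1)^k * (n choose k) * a k)" by simp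
  finally show ?thesis by (simp add: right_diff_distrib sum_subtractf)
qed

lemma signed_integral_dirac_minus:
  assumes M: "real_distribution M" and f: "f \<in> borel_measurable borel" "\<And>x. \<bar>f x\<bar> \<le> C"
  shows "signed_integral (dirac_minus M) f = f 0 - (\<integral>x. f x \<partial>M)"
proof -
  interpret real_distribution M by fact
  interpret D: prob_space "return borel (0::real)" by (rule prob_space_return) simp
  let ?N = "\<lambda>b. if b then return borel 0 else M" and ?c = "\<lambda>b. if b then 1 else - 1 :: real"
  have "dirac_minus M = (\<lambda>A. \<Sum>b\<in>{True, False}. ?c b * measure (?N b) A)"
    by (auto simp: dirac_minus_def)
  moreover have "signed_integral (\<lambda>A. \<Sum>b\<in>{True, False}. ?c b * measure (?N b) A) f =
      (\<Sum>b\<in>{True, False}. ?c b * (\<integral>x. f x \<partial>?N b))"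
    by (intro signed_integral_sum[OF _ _ _ f])
      (auto intro: finite_measure_axioms D.finite_measure_axioms)
  ultimately show ?thesis using f by (simp add: integral_return)
qed

text \<open>
  The binomial expansion of the \<open>l\<close>-th convolution power of the unit mass at 0 minus \<open>M\<close>. It avoids
  iterating Jordan decompositions: each power is a linear combination of probability measures.
\<close>

lemma signed_conv_power_dirac_minus:
  assumes M: "real_distribution M"
  shows "signed_conv_power (dirac_minus M) l A =
    (\<Sum>k\<le>l. (-1)^k * (l choose k) * measure (conv_power M k) A)"
proof (induction l arbitrary: A)
  case (Suc l)
  interpret M: real_distribution M by fact
  interpret c: real_distribution "conv_power M k" for k
    by (rule real_distribution_conv_power[OF M])
  define F where "F = (\<lambda>k x. measure (conv_power M k) {y. x + y \<in> A})"
  have "signed_conv_power (dirac_minus M) (Suc l) A =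
      signed_integral (dirac_minus M) (\<lambda>x. \<Sum>k\<le>l. (-1)^k * (l choose k) * F k x)"
    by (simp add: signed_convolution_def Suc F_def)
  also have "\<dots> = (\<Sum>k\<le>Suc l. (-1)^k * (Suc l choose k) * measure (conv_power M k) A)"
  proof (cases "A \<in> sets borel")
    case True
    have F[measurable]: "F k \<in> borel_measurable borel" for k
      unfolding F_def by (intro measurable_measure_shift real_distribution_conv_power M True)
    have F01: "0 \<le> F k x" "F k x \<le> 1" for k x by (auto simp: F_def)
    have int: "integrable M (F k)" for k
      by (rule M.integrable_const_bound[where B=1]) (use F01 F in simp_all)
    have bound: "\<bar>\<Sum>k\<le>l. (-1)^k * (l choose k) * F k x\<bar> \<le> (\<Sum>k\<le>l. real (l choose k))" for x
      using F01 by (intro order_trans[OF sum_abs] sum_mono) (auto simp: abs_mult mult_left_le)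
    have "signed_integral (dirac_minus M) (\<lambda>x. \<Sum>k\<le>l. (-1)^k * (l choose k) * F k x) =
        (\<Sum>k\<le>l. (-1)^k * (l choose k) * (F k 0 - (\<integral>x. F k x \<partial>M)))"
      using int by (subst signed_integral_dirac_minus[OF M _ bound])
        (auto simp: right_diff_distrib sum_subtractf)
    also have "\<dots> = (\<Sum>k\<le>l. (-1)^k * (l choose k) * (F k 0 - F (Suc k) 0))"
      unfolding F_def using measure_convolution[OF M real_distribution_conv_power[OF M] True] by simp
    finally show ?thesis
      unfolding alternating_binomial_step[of l "\<lambda>k. F k 0"] by (simp add: F_def)
  next
    case False
    then have "F k x = 0" for k x
      unfolding F_def using shift_in_borel_iff[of x A] by (intro measure_notin_sets) simp
    moreover have "signed_integral (dirac_minus M) (\<lambda>x. 0) = 0" by (simp add: signed_integral_def)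
    moreover have "measure (conv_power M k) A = 0" for k
      using False by (intro measure_notin_sets) simp
    ultimately show ?thesis by simp
  qed
  finally show ?case .
qed simp

lemma deconv_density_eq_sum:
  assumes M: "real_distribution M" and g: "g \<in> borel_measurable borel" "\<And>x. \<bar>g x\<bar> \<le> C"
  shows "deconv_density g M \<xi> m =
    (\<Sum>(l, k)\<in>(SIGMA l:{..m}. {..l}). (-1)^k * (l choose k) * (\<integral>x. g (\<xi> - x) \<partial>conv_power M k))"
proof -
  interpret c: real_distribution "conv_power M k" for k
    by (rule real_distribution_conv_power[OF M])
  let ?I = "SIGMA l:{..m}. {..l}"
  let ?c = "\<lambda>p. (-1)^snd p * real (fst p choose snd p)" and ?N = "\<lambda>p. conv_power M (snd p)"
  let ?\<nu> = "\<lambda>A. \<Sum>p\<in>?I. ?c p * measure (?N p) A"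
  note sum_facts = finite_signed_measure_sum[of ?I ?N ?c] signed_integral_sum[of ?I ?N "\<lambda>x. g (\<xi> - x)" C ?c]
  have [measurable]: "g \<in> borel_measurable borel" by fact
  have "(\<lambda>x. deconv_kernel M x m) = signed_cdf ?\<nu>"
    by (simp add: fun_eq_iff deconv_kernel_def signed_cdf_def signed_conv_power_dirac_minus[OF M]
        sum.Sigma split_beta)
  then have "deconv_density g M \<xi> m = signed_integral ?\<nu> (\<lambda>x. g (\<xi> - x))"
    unfolding deconv_density_def stieltjes_integral_def
    using sum_facts(1) c.finite_measure_axioms by (simp add: stieltjes_measure_signed_cdf)
  also have "\<dots> = (\<Sum>p\<in>?I. ?c p * (\<integral>x. g (\<xi> - x) \<partial>?N p))"
    using g(2) c.finite_measure_axioms by (intro sum_facts(2)) auto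
  finally show ?thesis by (simp add: split_beta)
qed

text \<open>
  The Fourier side of the deconvolution: \<open>s\<close> times the geometric sum of the powers of \<open>1 - s\<close>, in the
  binomially expanded form in which the kernel arises.
\<close>

lemma geometric_binomial_sum:
  fixes s :: "'a :: comm_ring_1"
  shows "(\<Sum>(l, k)\<in>(SIGMA l:{..m}. {..l}). (-1)^k * of_nat (l choose k) * (s * s ^ k)) =
    1 - (1 - s) ^ Suc m"
proof -
  have "(1 - s) ^ l = (\<Sum>k\<le>l. (-1)^k * of_nat (l choose k) * s ^ k)" for l
    using binomial_ring[of "- s" 1 l] by (simp add: power_minus[of s] ac_simps)
  then have "(\<Sum>(l, k)\<in>(SIGMA l:{..m}. {..l}). (-1)^k * of_nat (l choose k) * (s * s ^ k)) =
      (\<Sum>l\<le>m. s * (1 - s) ^ l)"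
    by (simp add: sum.Sigma[symmetric] sum_distrib_left ac_simps)
  also have "\<dots> = 1 - (1 - s) ^ Suc m"
  proof (induction m)
    case (Suc m)
    show ?case unfolding sum.atMost_Suc Suc.IH by (simp add: algebra_simps)
  qed simp
  finally show ?thesis .
qed

section \<open>Fourier inversion for integrable characteristic functions\<close>

text \<open>
  The transforms inverted below are characteristic functions times even real factors, so that the
  inversion integral is real; taking the real part in the definition makes the type reflect this.
\<close>

definition inv_fourier :: "(real \<Rightarrow> complex) \<Rightarrow> real \<Rightarrow> real" where
  "inv_fourier \<psi> x = Re (1 / (2 * pi) * (\<integral>t. iexp (- (t * x)) * \<psi> t \<partial>lborel))"

lemma integrable_mult_bounded:
  fixes \<psi> w :: "real \<Rightarrow> complex"
  assumes \<psi>: "integrable lborel \<psi>" and w: "w \<in> borel_measurable borel" "\<And>t. norm (w t) \<le> 1"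
  shows "integrable lborel (\<lambda>t. \<psi> t * w t)"
proof (rule Bochner_Integration.integrable_bound[OF \<psi>])
  have "\<psi> \<in> borel_measurable borel" using \<psi> by auto
  with w(1) show "(\<lambda>t. \<psi> t * w t) \<in> borel_measurable lborel" by simp
  show "AE t in lborel. norm (\<psi> t * w t) \<le> norm (\<psi> t)"
    using w(2) by (intro AE_I2) (simp add: norm_mult mult_left_le)
qed

lemma integrable_iexp_mult:
  assumes "integrable lborel \<psi>"
  shows "integrable lborel (\<lambda>t. iexp (- (t * x)) * \<psi> t)"
  using assms by (rule Bochner_Integration.integrable_bound) (use assms in \<open>auto simp: norm_mult\<close>)

lemma abs_inv_fourier_le:
  assumes "integrable lborel \<psi>"
  shows "\<bar>inv_fourier \<psi> x\<bar> \<le> (\<integral>t. norm (\<psi> t) \<partial>lborel) / (2 * pi)"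
proof -
  have "\<bar>inv_fourier \<psi> x\<bar> \<le> norm (1 / (2 * pi) * (\<integral>t. iexp (- (t * x)) * \<psi> t \<partial>lborel))"
    unfolding inv_fourier_def by (rule abs_Re_le_cmod)
  also have "\<dots> = norm (\<integral>t. iexp (- (t * x)) * \<psi> t \<partial>lborel) / (2 * pi)"
    by (simp add: norm_mult norm_divide)
  also have "norm (\<integral>t. iexp (- (t * x)) * \<psi> t \<partial>lborel) \<le> (\<integral>t. norm (iexp (- (t * x)) * \<psi> t) \<partial>lborel)"
    by (rule integral_norm_bound)
  also have "\<dots> = (\<integral>t. norm (\<psi> t) \<partial>lborel)" by (simp add: norm_mult)
  finally show ?thesis by (simp add: divide_right_mono)
qed

lemma continuous_inv_fourier:
  assumes \<psi>: "integrable lborel \<psi>"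
  shows "continuous_on UNIV (inv_fourier \<psi>)"
proof -
  have [measurable]: "\<psi> \<in> borel_measurable borel" using \<psi> by auto
  have "isCont (\<lambda>x. \<integral>t. iexp (- (t * x)) * \<psi> t \<partial>lborel) x" for x
    unfolding continuous_at_sequentially
  proof safe
    fix X assume "X \<longlonglongrightarrow> x"
    then show "((\<lambda>x. \<integral>t. iexp (- (t * x)) * \<psi> t \<partial>lborel) \<circ> X) \<longlonglongrightarrow> (\<integral>t. iexp (- (t * x)) * \<psi> t \<partial>lborel)"
      unfolding comp_def
      by (intro integral_dominated_convergence[where w="\<lambda>t. norm (\<psi> t)"])
        (auto simp: norm_mult \<psi> intro!: tendsto_intros)
  qed
  then show ?thesis
    unfolding inv_fourier_def by (intro continuous_at_imp_continuous_on ballI continuous_intros) auto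
qed

lemma inv_fourier_sum:
  assumes "\<And>i. i \<in> I \<Longrightarrow> integrable lborel (\<psi> i)"
  shows "(\<Sum>i\<in>I. c i * inv_fourier (\<psi> i) x) = inv_fourier (\<lambda>t. \<Sum>i\<in>I. complex_of_real (c i) * \<psi> i t) x"
proof -
  have "(\<integral>t. iexp (- (t * x)) * (\<Sum>i\<in>I. complex_of_real (c i) * \<psi> i t) \<partial>lborel) =
      (\<integral>t. (\<Sum>i\<in>I. complex_of_real (c i) * (iexp (- (t * x)) * \<psi> i t)) \<partial>lborel)"
    by (simp add: sum_distrib_left ac_simps)
  also have "\<dots> = (\<Sum>i\<in>I. \<integral>t. complex_of_real (c i) * (iexp (- (t * x)) * \<psi> i t) \<partial>lborel)"
    by (intro Bochner_Integration.integral_sum integrable_mult_right integrable_iexp_mult assms)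
  also have "\<dots> = (\<Sum>i\<in>I. complex_of_real (c i) * (\<integral>t. iexp (- (t * x)) * \<psi> i t \<partial>lborel))"
    by simp
  finally show ?thesis
    by (simp add: inv_fourier_def sum_divide_distrib sum_distrib_left)
qed

lemma inv_fourier_diff:
  assumes "integrable lborel \<psi>" "integrable lborel \<phi>"
  shows "inv_fourier (\<lambda>t. \<psi> t - \<phi> t) x = inv_fourier \<psi> x - inv_fourier \<phi> x"
proof -
  have "(\<integral>t. iexp (- (t * x)) * (\<psi> t - \<phi> t) \<partial>lborel) =
      (\<integral>t. iexp (- (t * x)) * \<psi> t \<partial>lborel) - (\<integral>t. iexp (- (t * x)) * \<phi> t \<partial>lborel)"
    unfolding right_diff_distrib
    by (intro Bochner_Integration.integral_diff integrable_iexp_mult assms)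
  then show ?thesis by (simp add: inv_fourier_def diff_divide_distrib)
qed

lemma integral_inv_fourier_shift:
  assumes "real_distribution M" and \<psi>: "integrable lborel \<psi>"
  shows "(\<integral>x. inv_fourier \<psi> (\<xi> - x) \<partial>M) = inv_fourier (\<lambda>t. \<psi> t * char M t) \<xi>"
proof -
  interpret real_distribution M by fact
  interpret pair_sigma_finite lborel M ..
  have [measurable]: "\<psi> \<in> borel_measurable borel" using \<psi> by auto
  let ?f = "\<lambda>t x. iexp (- (t * (\<xi> - x))) * \<psi> t"
  have "integrable (lborel \<Otimes>\<^sub>M M) (case_prod ?f)"
  proof (rule Fubini_integrable)
    show "integrable lborel (\<lambda>t. \<integral>x. norm (case (t, x) of (t, x) \<Rightarrow> ?f t x) \<partial>M)"
      using \<psi> prob_space by (simp add: norm_mult)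
    show "AE t in lborel. integrable M (\<lambda>x. case (t, x) of (t, x) \<Rightarrow> ?f t x)"
      by (intro AE_I2 integrable_const_bound[where B="norm (\<psi> _)"]) (auto simp: norm_mult)
  qed simp
  note int = this
  have inner: "(\<integral>x. ?f t x \<partial>M) = iexp (- (t * \<xi>)) * (\<psi> t * char M t)" for t
  proof -
    have "?f t x = iexp (- (t * \<xi>)) * \<psi> t * iexp (t * x)" for x
      by (simp add: algebra_simps exp_add[symmetric])
    then show ?thesis by (simp only: char_def integral_mult_right_zero mult.assoc)
  qed
  have "(\<integral>x. inv_fourier \<psi> (\<xi> - x) \<partial>M) = Re (\<integral>x. 1 / (2 * pi) * (\<integral>t. ?f t x \<partial>lborel) \<partial>M)"
    unfolding inv_fourier_def
    by (rule integral_Re) (intro integrable_mult_right integrable_snd[OF int])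
  also have "(\<integral>x. 1 / (2 * pi) * (\<integral>t. ?f t x \<partial>lborel) \<partial>M) = 1 / (2 * pi) * (\<integral>x. (\<integral>t. ?f t x \<partial>lborel) \<partial>M)"
    by simp
  also have "(\<integral>x. (\<integral>t. ?f t x \<partial>lborel) \<partial>M) = (\<integral>t. (\<integral>x. ?f t x \<partial>M) \<partial>lborel)"
    by (rule Fubini_integral[OF int])
  finally show ?thesis by (simp only: inner inv_fourier_def)
qed

lemma difference_quotient_iexp_le:
  assumes "t \<noteq> 0"
  shows "cmod ((iexp (- (t * x)) - iexp (- (t * y))) / (\<i> * t)) \<le> \<bar>y - x\<bar>"
proof (cases "x \<le> y")
  case True
  then show ?thesis using Levy_Inversion_aux2[of "-y" "-x" t] assms by simp
next
  case False
  then show ?thesis using Levy_Inversion_aux2[of "-x" "-y" t] assms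
    by (simp add: norm_divide norm_minus_commute)
qed

lemma integrable_iexp_difference:
  assumes "integrable lborel \<phi>"
  shows "integrable lborel (\<lambda>t. (iexp (- (t * x)) - iexp (- (t * y))) / (\<i> * t) * \<phi> t)"
proof (rule Bochner_Integration.integrable_bound)
  show "integrable lborel (\<lambda>t. \<bar>y - x\<bar> * norm (\<phi> t))" using assms by simp
  show "AE t in lborel. norm ((iexp (- (t * x)) - iexp (- (t * y))) / (\<i> * t) * \<phi> t) \<le> norm (\<bar>y - x\<bar> * norm (\<phi> t))"
    using AE_lborel_singleton[of 0]
  proof eventually_elim
    case (elim t)
    from mult_right_mono[OF difference_quotient_iexp_le[OF elim] norm_ge_zero]
    show ?case by (simp add: norm_mult abs_mult del: times_divide_eq_left)
  qed
  have [measurable]: "\<phi> \<in> borel_measurable borel" using assms by auto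
  show "(\<lambda>t. (iexp (- (t * x)) - iexp (- (t * y))) / (\<i> * t) * \<phi> t) \<in> borel_measurable lborel" by measurable
qed

text \<open>
  Levy's inversion formula; the truncated integrals converge to an absolutely convergent one since the
  difference of exponentials over \<open>\<i> t\<close> is bounded by \<open>\<bar>y - x\<bar>\<close> and multiplies an integrable function.
\<close>

lemma cdf_diff_eq_integral:
  assumes "real_distribution M" and int: "integrable lborel (char M)" and atom: "\<And>x. measure M {x} = 0"
  shows "cdf M y - cdf M x =
    Re (1 / (2 * pi) * (\<integral>t. (iexp (- (t * x)) - iexp (- (t * y))) / (\<i> * t) * char M t \<partial>lborel))"
    (is "_ = ?R x y")
proof -
  interpret real_distribution M by fact
  have le: "cdf M b - cdf M a = ?R a b" if "a \<le> b" for a b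
  proof (cases "a = b")
    case False
    let ?F = "\<lambda>t. (iexp (- (t * a)) - iexp (- (t * b))) / (\<i> * t) * char M t"
    have "(\<lambda>T::nat. \<integral>t. indicator {- real T<..<real T} t *\<^sub>R ?F t \<partial>lborel) \<longlonglongrightarrow> (\<integral>t. ?F t \<partial>lborel)"
    proof (rule integral_dominated_convergence[where w="\<lambda>t. norm (?F t)"])
      show "AE t in lborel. (\<lambda>T::nat. indicator {- real T<..<real T} t *\<^sub>R ?F t) \<longlonglongrightarrow> ?F t"
      proof (intro AE_I2 tendsto_eventually)
        fix t :: real
        obtain n :: nat where "\<bar>t\<bar> < n" using reals_Archimedean2[of "\<bar>t\<bar>"] by blast
        then show "\<forall>\<^sub>F T::nat in sequentially. indicator {- real T<..<real T} t *\<^sub>R ?F t = ?F t"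
          by (intro eventually_sequentiallyI[of n]) (simp add: abs_less_iff)
      qed
      show "AE t in lborel. norm (indicator {- real T<..<real T} t *\<^sub>R ?F t) \<le> norm (?F t)" for T :: nat
        by (intro AE_I2) (simp split: split_indicator)
      show "integrable lborel (\<lambda>t. norm (?F t))"
        by (intro integrable_norm integrable_iexp_difference int)
    qed simp_all
    then have "(\<lambda>T::nat. CLBINT t=ereal (real_of_int (- int T))..ereal (real T). ?F t) \<longlonglongrightarrow> (\<integral>t. ?F t \<partial>lborel)"
      by (simp add: interval_lebesgue_integral_def set_lebesgue_integral_def)
    from LIMSEQ_unique[OF tendsto_mult_left[OF this] Levy_Inversion[OF that atom atom]]
    have "complex_of_real (measure M {a<..b}) = 1 / (2 * pi) * (\<integral>t. ?F t \<partial>lborel)" by simp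
    from arg_cong[OF this, of Re] have "measure M {a<..b} = ?R a b"
      by (simp only: Re_complex_of_real)
    then show ?thesis using cdf_diff_eq[of a b] False that by simp
  qed simp
  show ?thesis
  proof (cases "x \<le> y")
    case False
    have swap: "(iexp (- (t * x)) - iexp (- (t * y))) / (\<i> * t) * char M t =
        - ((iexp (- (t * y)) - iexp (- (t * x))) / (\<i> * t) * char M t)" for t
      by (simp only: minus_mult_left minus_divide_left minus_diff_eq)
    show ?thesis using le[of y x] False unfolding swap by simp
  qed (rule le)
qed

text \<open>
  The difference quotients of the kernel in the inversion formula are bounded by 1 and converge to
  \<open>exp (- \<i> t x)\<close>, so the derivative may be taken under the integral.
\<close>

lemma cdf_has_derivative_inv_fourier:
  assumes M: "real_distribution M" and int: "integrable lborel (char M)" and atom: "\<And>x. measure M {x} = 0"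
  shows "(cdf M has_real_derivative inv_fourier (char M) x) (at x)"
  unfolding has_field_derivative_iff tendsto_at_iff_sequentially comp_def
proof (intro allI impI)
  interpret real_distribution M by fact
  fix X :: "nat \<Rightarrow> real" assume X: "\<forall>n. X n \<in> UNIV - {x}" and lim: "X \<longlonglongrightarrow> x"
  let ?q = "\<lambda>n t. (iexp (- (t * x)) - iexp (- (t * X n))) / (\<i> * t) / complex_of_real (X n - x) * char M t"
  have "(\<lambda>n. \<integral>t. ?q n t \<partial>lborel) \<longlonglongrightarrow> (\<integral>t. iexp (- (t * x)) * char M t \<partial>lborel)"
  proof (rule integral_dominated_convergence[where w="\<lambda>t. norm (char M t)"])
    show "AE t in lborel. (\<lambda>n. ?q n t) \<longlonglongrightarrow> iexp (- (t * x)) * char M t"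
      using AE_lborel_singleton[of 0]
    proof eventually_elim
      case (elim t)
      let ?z = "\<lambda>n. \<i> * complex_of_real (- (t * (X n - x)))"
      have "filterlim ?z (at 0) sequentially"
        unfolding filterlim_at using X elim
        by (auto intro!: tendsto_eq_intros lim)
      then have "(\<lambda>n. (exp (?z n) - 1) / ?z n) \<longlonglongrightarrow> 1"
        by (rule filterlim_compose[OF lim_exp_minus_1])
      then have "(\<lambda>n. iexp (- (t * x)) * ((exp (?z n) - 1) / ?z n) * char M t) \<longlonglongrightarrow> iexp (- (t * x)) * 1 * char M t"
        by (intro tendsto_intros)
      moreover have "iexp (- (t * x)) * ((exp (?z n) - 1) / ?z n) * char M t = ?q n t" for n
      proof -
        have "iexp (- (t * x)) * exp (?z n) = iexp (- (t * X n))"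
          by (simp add: exp_add[symmetric] algebra_simps)
        then have "iexp (- (t * x)) * (exp (?z n) - 1) = iexp (- (t * X n)) - iexp (- (t * x))"
          by (simp add: algebra_simps)
        then have "iexp (- (t * x)) * ((exp (?z n) - 1) / ?z n) =
           (iexp (- (t * X n)) - iexp (- (t * x))) / ?z n" by (simp only: times_divide_eq_right)
        also have "\<dots> = (iexp (- (t * X n)) - iexp (- (t * x))) / - (\<i> * t * complex_of_real (X n - x))"
          by (rule arg_cong[where f="\<lambda>w. _ / w"]) simp
        also have "\<dots> = (iexp (- (t * x)) - iexp (- (t * X n))) / (\<i> * t) / complex_of_real (X n - x)"
          by (simp only: minus_divide_right[symmetric] minus_divide_left minus_diff_eq divide_divide_eq_left)
        finally show ?thesis by (rule arg_cong)
      qed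
      ultimately show ?case by simp
    qed
    show "AE t in lborel. norm (?q n t) \<le> norm (char M t)" for n
      using AE_lborel_singleton[of 0]
    proof eventually_elim
      case (elim t)
      have "\<bar>X n - x\<bar> > 0" using X by auto
      then have "norm ((iexp (- (t * x)) - iexp (- (t * X n))) / (\<i> * t) / complex_of_real (X n - x)) \<le> 1"
        using difference_quotient_iexp_le[OF elim, of x "X n"]
        by (subst norm_divide) (simp add: divide_le_eq del: of_real_diff)
      then show ?case
        by (subst norm_mult) (rule mult_left_le_one_le, auto)
    qed
  qed (use int in simp_all)
  then have "(\<lambda>n. Re (1 / (2 * pi) * (\<integral>t. ?q n t \<partial>lborel))) \<longlonglongrightarrow> inv_fourier (char M) x"
    unfolding inv_fourier_def by (intro tendsto_Re tendsto_mult_left)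
  moreover have "Re (1 / (2 * pi) * (\<integral>t. ?q n t \<partial>lborel)) = (cdf M (X n) - cdf M x) / (X n - x)" for n
  proof -
    have "?q n t = (iexp (- (t * x)) - iexp (- (t * X n))) / (\<i> * t) * char M t / complex_of_real (X n - x)" for t
      by simp
    then have "(\<integral>t. ?q n t \<partial>lborel) =
      (\<integral>t. (iexp (- (t * x)) - iexp (- (t * X n))) / (\<i> * t) * char M t \<partial>lborel) / complex_of_real (X n - x)"
      by (simp only: integral_divide_zero)
    then have "1 / (2 * pi) * (\<integral>t. ?q n t \<partial>lborel) =
      (1 / (2 * pi) * (\<integral>t. (iexp (- (t * x)) - iexp (- (t * X n))) / (\<i> * t) * char M t \<partial>lborel)) / complex_of_real (X n - x)"
      by simp
    then show ?thesis
      by (simp only: Re_divide_of_real cdf_diff_eq_integral[OF M int atom])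
  qed
  ultimately show "(\<lambda>n. (cdf M (X n) - cdf M x) / (X n - x)) \<longlonglongrightarrow> inv_fourier (char M) x"
    by simp
qed

text \<open>
  The inverse transform is the derivative of the monotone distribution function, hence nonnegative; by
  the fundamental theorem of calculus, the measure with this density agrees with \<open>M\<close> on half-open
  intervals, and densities are unique almost everywhere.
\<close>

lemma density_eq_inv_fourier:
  assumes M: "real_distribution M" and int: "integrable lborel (char M)"
    and f: "has_lebesgue_density M f"
  shows "AE x in lborel. f x = inv_fourier (char M) x"
proof -
  interpret real_distribution M by fact
  let ?h = "inv_fourier (char M)"
  have [measurable]: "f \<in> borel_measurable borel" and f0: "AE x in lborel. 0 \<le> f x"
    and M_eq: "M = density lborel (\<lambda>x. ennreal (f x))"
    using f unfolding has_lebesgue_density_def by blast+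
  have [measurable]: "?h \<in> borel_measurable borel"
    using continuous_inv_fourier[OF int] by (rule borel_measurable_continuous_onI)
  have "emeasure M {x} = 0" for x
    by (subst M_eq) (simp add: emeasure_density nn_integral_null_set)
  then have atom: "measure M {x} = 0" for x by (simp add: measure_def)
  note deriv = cdf_has_derivative_inv_fourier[OF M int atom]
  have h0: "0 \<le> ?h x" for x
  proof (rule tendsto_lowerbound)
    show "((\<lambda>y. (cdf M y - cdf M x) / (y - x)) \<longlongrightarrow> ?h x) (at x)"
      using deriv[of x] by (simp add: has_field_derivative_iff)
    show "\<forall>\<^sub>F y in at x. 0 \<le> (cdf M y - cdf M x) / (y - x)"
    proof (rule always_eventually, rule allI)
      fix y show "0 \<le> (cdf M y - cdf M x) / (y - x)"
        using cdf_nondecreasing[of x y] cdf_nondecreasing[of y x]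
        by (cases "x \<le> y") (auto intro: divide_nonpos_nonpos)
    qed
  qed simp
  have "M = density lborel (\<lambda>x. ennreal (?h x))"
  proof (rule measure_eqI_generator_eq[where \<Omega>=UNIV and E="range (\<lambda>(a, b). {a<..b::real})" and A="\<lambda>n. {- real n<..real n}"])
    fix A assume "A \<in> range (\<lambda>(a, b). {a<..b::real})"
    then obtain a b where A: "A = {a<..b}" by auto
    show "emeasure M A = emeasure (density lborel (\<lambda>x. ennreal (?h x))) A"
    proof (cases "a < b")
      case True
      have "emeasure (density lborel (\<lambda>x. ennreal (?h x))) A = (\<integral>\<^sup>+x. ennreal (?h x) * indicator {a..b} x \<partial>lborel)"
      proof -
        have "AE x in lborel. ennreal (?h x) * indicator A x = ennreal (?h x) * indicator {a..b} x"
          using AE_lborel_singleton[of a]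
          by eventually_elim (auto simp: A split: split_indicator)
        then show ?thesis by (subst emeasure_density) (auto intro: nn_integral_cong_AE simp: A)
      qed
      also have "\<dots> = ennreal (cdf M b - cdf M a)"
        using True deriv h0 by (intro nn_integral_FTC_Icc) simp_all
      finally show ?thesis using cdf_diff_eq[OF True] by (simp add: A emeasure_eq_measure)
    qed (simp add: A)
  next
    show "Int_stable (range (\<lambda>(a, b). {a<..b::real}))"
      by (auto simp: Int_stable_def)
  next
    show "(\<Union>i. {- real (i::nat)<..real i}) = UNIV" by (rule UN_Ioc_eq_UNIV)
  qed (auto simp: borel_sigma_sets_Ioc emeasure_eq_measure M_is_borel)
  then have "density lborel (\<lambda>x. ennreal (f x)) = density lborel (\<lambda>x. ennreal (?h x))"
    using M_eq by simp
  then have "AE x in lborel. ennreal (f x) = ennreal (?h x)"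
    by (intro sigma_finite_measure.density_unique[OF sigma_finite_lborel]) simp_all
  with f0 show ?thesis
    by eventually_elim (use h0 in simp)
qed

section \<open>Convergence in the essential supremum norm\<close>

lemma Linf_norm_nonneg: "0 \<le> Linf_norm f"
proof -
  have "esssup lborel (\<lambda>x::real. 0 :: ereal) \<le> Linf_norm f"
    unfolding Linf_norm_def by (rule esssup_mono) simp_all
  then show ?thesis by (simp add: esssup_const)
qed

lemma Linf_norm_le:
  assumes "f \<in> borel_measurable borel" "AE x in lborel. \<bar>f x\<bar> \<le> c"
  shows "Linf_norm f \<le> ereal c"
  unfolding Linf_norm_def by (rule esssup_I) (use assms in simp_all)

lemma Linf_norm_perturb:
  assumes f: "f \<in> borel_measurable borel" and d: "\<And>x. \<bar>f x - g x\<bar> \<le> c"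
  shows "Linf_norm f \<le> Linf_norm g + ereal c"
  unfolding Linf_norm_def
proof (rule esssup_I)
  show "AE x in lborel. ereal \<bar>f x\<bar> \<le> esssup lborel (\<lambda>x. ereal \<bar>g x\<bar>) + ereal c"
    using esssup_AE[of "\<lambda>x. ereal \<bar>g x\<bar>" lborel]
  proof eventually_elim
    case (elim x)
    have "\<bar>f x\<bar> \<le> \<bar>g x\<bar> + c" using d[of x] by linarith
    then have "ereal \<bar>f x\<bar> \<le> ereal \<bar>g x\<bar> + ereal c" by simp
    also have "\<dots> \<le> esssup lborel (\<lambda>x. ereal \<bar>g x\<bar>) + ereal c" by (rule add_right_mono[OF elim])
    finally show ?case .
  qed
qed (use f in simp)

lemma Linf_norm_cong_AE:
  assumes "f \<in> borel_measurable borel" "g \<in> borel_measurable borel" "AE x in lborel. \<bar>f x\<bar> = \<bar>g x\<bar>"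
  shows "Linf_norm f = Linf_norm g"
  unfolding Linf_norm_def by (rule esssup_AE_cong) (use assms in simp_all)

lemma tendsto_Linf_norm:
  assumes u: "\<And>m. u m \<in> borel_measurable borel" and v: "v \<in> borel_measurable borel"
    and d: "\<And>m x. \<bar>u m x - v x\<bar> \<le> c m" and c: "c \<longlonglongrightarrow> 0"
  shows "(\<lambda>m. Linf_norm (u m)) \<longlonglongrightarrow> Linf_norm v"
proof (rule tendsto_sandwich)
  have c': "(\<lambda>m. ereal (c m)) \<longlonglongrightarrow> 0" using c by (simp add: zero_ereal_def)
  have le: "Linf_norm v \<le> Linf_norm (u m) + ereal (c m)" for m
    using d by (intro Linf_norm_perturb v) (simp add: abs_minus_commute)
  show "\<forall>\<^sub>F m in sequentially. Linf_norm v - ereal (c m) \<le> Linf_norm (u m)"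
    using le by (intro always_eventually allI) (simp add: ereal_minus_le)
  show "\<forall>\<^sub>F m in sequentially. Linf_norm (u m) \<le> Linf_norm v + ereal (c m)"
    using d by (intro always_eventually allI Linf_norm_perturb u)
  show "(\<lambda>m. Linf_norm v - ereal (c m)) \<longlonglongrightarrow> Linf_norm v"
    using tendsto_diff_ereal_general[OF tendsto_const c', of "Linf_norm v"] by simp
  show "(\<lambda>m. Linf_norm v + ereal (c m)) \<longlonglongrightarrow> Linf_norm v"
    using tendsto_add_ereal_general[OF _ tendsto_const c', of "Linf_norm v"] by simp
qed

text \<open>
  The powers \<open>r ^ Suc m\<close> tend pointwise to the indicator of \<open>{r = 1}\<close>. Dominated convergence gives
  convergence in \<open>L\<^sup>1\<close> of the functions and hence uniform convergence of their inverse transforms.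
\<close>

lemma tendsto_Linf_norm_inv_fourier_power:
  assumes \<psi>: "integrable lborel \<psi>" and r: "r \<in> borel_measurable borel"
    and r01: "\<And>t. 0 \<le> r t" "\<And>t. r t \<le> (1::real)"
  shows "(\<lambda>m. Linf_norm (inv_fourier (\<lambda>t. \<psi> t * complex_of_real (r t ^ Suc m)))) \<longlonglongrightarrow>
    Linf_norm (inv_fourier (\<lambda>t. \<psi> t * complex_of_real (of_bool (r t = 1))))"
proof -
  have [measurable]: "\<psi> \<in> borel_measurable borel" "r \<in> borel_measurable borel" using \<psi> r by auto
  have int: "integrable lborel (\<lambda>t. \<psi> t * complex_of_real (w t))"
    if "w \<in> borel_measurable borel" "\<And>t. \<bar>w t\<bar> \<le> 1" for w
    by (rule integrable_mult_bounded[OF \<psi>]) (use that in simp_all)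
  define w where "w = (\<lambda>m t. r t ^ Suc m)"
  define z where "z = (\<lambda>t. of_bool (r t = 1) :: real)"
  have pow: "0 \<le> r t ^ Suc m" "r t ^ Suc m \<le> 1" for t m
    using r01 by (auto intro: power_le_one simp del: power_Suc)
  have w: "integrable lborel (\<lambda>t. \<psi> t * complex_of_real (w m t))" for m
    by (rule int) (use pow in \<open>simp_all add: w_def del: power_Suc\<close>)
  have z: "integrable lborel (\<lambda>t. \<psi> t * complex_of_real (z t))"
    by (rule int) (simp_all add: z_def)
  have borel: "inv_fourier \<phi> \<in> borel_measurable borel" if "integrable lborel \<phi>" for \<phi>
    by (rule borel_measurable_continuous_onI[OF continuous_inv_fourier[OF that]])
  have diff: "(\<lambda>t. \<psi> t * complex_of_real (w m t) - \<psi> t * complex_of_real (z t)) =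
      (\<lambda>t. \<psi> t * complex_of_real (w m t - z t))" for m
    by (simp add: right_diff_distrib)
  have wz: "\<bar>w m t - z t\<bar> \<le> 1" for m t
    using pow[of t m] by (simp add: w_def z_def del: power_Suc)
  have "(\<lambda>m. Linf_norm (inv_fourier (\<lambda>t. \<psi> t * complex_of_real (w m t)))) \<longlonglongrightarrow>
      Linf_norm (inv_fourier (\<lambda>t. \<psi> t * complex_of_real (z t)))"
  proof (rule tendsto_Linf_norm)
    fix m x
    show "\<bar>inv_fourier (\<lambda>t. \<psi> t * complex_of_real (w m t)) x - inv_fourier (\<lambda>t. \<psi> t * complex_of_real (z t)) x\<bar>
      \<le> (\<integral>t. norm (\<psi> t * complex_of_real (w m t - z t)) \<partial>lborel) / (2 * pi)"
      unfolding inv_fourier_diff[OF w z, symmetric] diff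
      by (rule abs_inv_fourier_le) (simp only: diff[symmetric] Bochner_Integration.integrable_diff[OF w z])
  next
    have "(\<lambda>m. \<integral>t. norm (\<psi> t * complex_of_real (w m t - z t)) \<partial>lborel) \<longlonglongrightarrow> integral\<^sup>L lborel (\<lambda>t::real. 0 :: real)"
    proof (rule integral_dominated_convergence[where w="\<lambda>t. norm (\<psi> t)"])
      show "AE t in lborel. (\<lambda>m. norm (\<psi> t * complex_of_real (w m t - z t))) \<longlonglongrightarrow> 0"
      proof (intro AE_I2)
        fix t
        have "(\<lambda>m. w m t) \<longlonglongrightarrow> z t"
        proof (cases "r t = 1")
          case False
          with r01[of t] have "(\<lambda>m. r t ^ m) \<longlonglongrightarrow> 0" by (intro LIMSEQ_power_zero) simp
          from LIMSEQ_Suc[OF this] False show ?thesis by (simp add: w_def z_def)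
        qed (simp add: w_def z_def)
        then have "(\<lambda>m. \<psi> t * complex_of_real (w m t - z t)) \<longlonglongrightarrow> \<psi> t * complex_of_real (z t - z t)"
          by (intro tendsto_mult_left tendsto_of_real tendsto_diff tendsto_const)
        then show "(\<lambda>m. norm (\<psi> t * complex_of_real (w m t - z t))) \<longlonglongrightarrow> 0"
          by (intro tendsto_norm_zero) simp
      qed
      show "AE t in lborel. norm (norm (\<psi> t * complex_of_real (w m t - z t))) \<le> norm (\<psi> t)" for m
        using wz by (intro AE_I2) (simp add: norm_mult mult_left_le del: of_real_diff)
    qed (use \<psi> in \<open>simp_all add: w_def z_def\<close>)
    then show "(\<lambda>m. (\<integral>t. norm (\<psi> t * complex_of_real (w m t - z t)) \<partial>lborel) / (2 * pi)) \<longlonglongrightarrow> 0"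
      by (intro tendsto_divide_zero) simp
  qed (intro borel w z)+
  then show ?thesis by (simp add: w_def z_def)
qed

section \<open>The deconvolution density\<close>

lemma ereal_in_char_zeros_iff: "ereal t \<in> char_zeros M \<longleftrightarrow> char M t = 0"
  by (auto simp: char_zeros_def)

lemma AE_eq_continuous_imp_eq:
  fixes f g :: "real \<Rightarrow> real"
  assumes "continuous_on UNIV f" "continuous_on UNIV g" "AE x in lborel. f x = g x"
  shows "f = g"
proof
  fix x
  have "closed {x. f x = g x}"
    using assms(1,2) by (rule closed_Collect_eq)
  moreover have "AE x in lebesgue. x \<in> {x. f x = g x}"
    using assms(3) by (intro AE_completion) simp
  ultimately have "x \<in> {x. f x = g x}" by (rule mem_closed_if_AE_lebesgue)
  then show "f x = g x" by simp
qed

text \<open>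
  By continuity, \<open>g\<close> is everywhere the inverse transform of \<open>char chi * char M\<close>. Averaging its
  translates against the \<open>k\<close>-th convolution power multiplies the transform by \<open>char M ^ k\<close>, and the
  binomial sum of these products telescopes.
\<close>

lemma deconv_density_eq_inv_fourier:
  assumes chi: "real_distribution chi" and M: "real_distribution M"
    and \<phi>: "integrable lborel (char chi)"
    and g: "has_lebesgue_density (convolution chi M) g" "continuous_on UNIV g"
  shows "deconv_density g M \<xi> m =
    inv_fourier (\<lambda>t. char chi t - char chi t * (1 - char M t) ^ Suc m) \<xi>"
proof -
  interpret c: real_distribution "conv_power M k" for k
    by (rule real_distribution_conv_power[OF M])
  have bounded_mult: "integrable lborel (\<lambda>t. \<psi> t * char N t)"
    if "real_distribution N" "integrable lborel \<psi>" for \<psi> N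
    using that by (intro integrable_mult_bounded real_distribution.char_measurable
      real_distribution.cmod_char_le_1)
  let ?N = "convolution chi M"
  have N: "real_distribution ?N" by (rule real_distribution_convolution[OF chi M])
  have char_N: "char ?N = (\<lambda>t. char chi t * char M t)"
    by (rule ext) (rule char_convolution[OF chi M])
  have int: "integrable lborel (char ?N)"
    unfolding char_N by (rule bounded_mult[OF M \<phi>])
  have g_eq: "g = inv_fourier (char ?N)"
    by (rule AE_eq_continuous_imp_eq[OF g(2) continuous_inv_fourier[OF int] density_eq_inv_fourier[OF N int g(1)]])
  have g_borel: "g \<in> borel_measurable borel"
    using g(2) by (rule borel_measurable_continuous_onI)
  have g_bounded: "\<bar>g x\<bar> \<le> (\<integral>t. norm (char ?N t) \<partial>lborel) / (2 * pi)" for x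
    unfolding g_eq by (rule abs_inv_fourier_le[OF int])
  let ?I = "SIGMA l:{..m}. {..l}"
  let ?c = "\<lambda>p. (-1)^snd p * real (fst p choose snd p)"
  have shift: "(\<integral>x. g (\<xi> - x) \<partial>conv_power M k) = inv_fourier (\<lambda>t. char ?N t * char (conv_power M k) t) \<xi>" for k
    unfolding g_eq by (rule integral_inv_fourier_shift[OF c.real_distribution_axioms int])
  have "deconv_density g M \<xi> m =
      (\<Sum>p\<in>?I. ?c p * inv_fourier (\<lambda>t. char ?N t * char (conv_power M (snd p)) t) \<xi>)"
    unfolding deconv_density_eq_sum[OF M g_borel g_bounded] shift by (simp add: split_beta)
  also have "\<dots> = inv_fourier (\<lambda>t. \<Sum>p\<in>?I. complex_of_real (?c p) * (char ?N t * char (conv_power M (snd p)) t)) \<xi>"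
    by (rule inv_fourier_sum) (rule bounded_mult[OF c.real_distribution_axioms int])
  also have "(\<lambda>t. \<Sum>p\<in>?I. complex_of_real (?c p) * (char ?N t * char (conv_power M (snd p)) t)) =
      (\<lambda>t. char chi t - char chi t * (1 - char M t) ^ Suc m)"
  proof
    fix t
    have "(\<Sum>p\<in>?I. complex_of_real (?c p) * (char ?N t * char (conv_power M (snd p)) t)) =
        char chi t * (\<Sum>(l, k)\<in>?I. (-1)^k * of_nat (l choose k) * (char M t * char M t ^ k))"
      unfolding sum_distrib_left
      by (rule sum.cong) (simp_all add: split_beta char_N char_conv_power[OF M])
    also have "\<dots> = char chi t - char chi t * (1 - char M t) ^ Suc m"
      unfolding geometric_binomial_sum by (simp only: right_diff_distrib mult_1_right)
    finally show "(\<Sum>p\<in>?I. complex_of_real (?c p) * (char ?N t * char (conv_power M (snd p)) t)) =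
      char chi t - char chi t * (1 - char M t) ^ Suc m" .
  qed
  finally show ?thesis .
qed

theorem corollary6p1:
  fixes chi mu mu_s iota :: "real measure"
    and f_chi g f_iota :: "real \<Rightarrow> real"
  assumes "real_distribution chi"
    and "real_distribution mu"
    and "symmetrization mu mu_s"
    and "has_lebesgue_density chi f_chi"
    and "has_lebesgue_density (convolution chi mu_s) g"
    and "continuous_on UNIV g"
    and "real_distribution iota"
    and "has_lebesgue_density iota f_iota"
    and "f_iota \<in> O[at_top](\<lambda>\<xi>. 1 / \<xi>\<^sup>2)"
    and "f_iota \<in> O[at_bot](\<lambda>\<xi>. 1 / \<xi>\<^sup>2)"
    and "integrable lborel (char iota)"
    and "integrable lborel (char chi)"
  shows "(\<exists>L::real. 0 \<le> L \<and>
            (\<lambda>m. Linf_norm (\<lambda>\<xi>. deconv_density g mu_s \<xi> m - f_chi \<xi>)) \<longlonglongrightarrow> ereal L) \<and>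
         ({t::real. ereal t \<in> char_zeros mu - char_zeros chi} \<in> null_sets lebesgue \<longrightarrow>
            (\<lambda>m. Linf_norm (\<lambda>\<xi>. deconv_density g mu_s \<xi> m - f_chi \<xi>)) \<longlonglongrightarrow> 0)"
proof -
  note chi = assms(1) and \<phi> = assms(12)
  have mu_s: "real_distribution mu_s" and zeros: "char_zeros mu_s = char_zeros mu"
    and real_char: "\<exists>r\<in>{0..1}. char mu_s t = complex_of_real r" for t
    using assms(3) unfolding symmetrization_def by blast+
  interpret mu_s: real_distribution mu_s by (rule mu_s)
  define s where "s = (\<lambda>t. Re (char mu_s t))"
  have s: "char mu_s t = complex_of_real (s t)" "0 \<le> s t" "s t \<le> 1" for t
    using real_char[of t] by (auto simp: s_def)
  have s_borel: "s \<in> borel_measurable borel"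
    unfolding s_def using mu_s.char_measurable by simp
  \<comment> \<open>transforms of the error with index \<open>m\<close>, up to sign, and of its limit; \<open>1 - s t = 1\<close> holds on the zero set of \<open>s\<close>\<close>
  let ?e = "\<lambda>m t. char chi t * complex_of_real ((1 - s t) ^ Suc m)"
  let ?e_lim = "\<lambda>t. char chi t * complex_of_real (of_bool (1 - s t = 1))"
  note [measurable] = s_borel
  have int: "integrable lborel (\<lambda>t. char chi t * complex_of_real (w t))"
    if "w \<in> borel_measurable borel" "\<And>t. \<bar>w t\<bar> \<le> 1" for w
    by (rule integrable_mult_bounded[OF \<phi>]) (use that in simp_all)
  have pow: "\<bar>(1 - s t) ^ Suc m\<bar> \<le> 1" for t m
    using s(2,3)[of t] by (simp add: power_le_one del: power_Suc)
  have e: "integrable lborel (?e m)" for m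
    by (rule int) (use pow in \<open>simp_all del: power_Suc\<close>)
  have e_lim: "integrable lborel ?e_lim"
    by (rule int) simp_all
  have f_borel: "f_chi \<in> borel_measurable borel"
    using assms(4) by (simp add: has_lebesgue_density_def)
  have inv_borel: "inv_fourier \<psi> \<in> borel_measurable borel" if "integrable lborel \<psi>" for \<psi>
    by (rule borel_measurable_continuous_onI[OF continuous_inv_fourier[OF that]])
  have norm_eq: "Linf_norm (\<lambda>\<xi>. deconv_density g mu_s \<xi> m - f_chi \<xi>) = Linf_norm (inv_fourier (?e m))" for m
  proof -
    have d: "deconv_density g mu_s \<xi> m = inv_fourier (char chi) \<xi> - inv_fourier (?e m) \<xi>" for \<xi>
      unfolding deconv_density_eq_inv_fourier[OF chi mu_s \<phi> assms(5,6)]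
        inv_fourier_diff[OF \<phi> e, symmetric] s(1)
      by (simp del: power_Suc)
    show ?thesis
    proof (rule Linf_norm_cong_AE)
      show "(\<lambda>\<xi>. deconv_density g mu_s \<xi> m - f_chi \<xi>) \<in> borel_measurable borel"
        unfolding d by (intro borel_measurable_diff inv_borel \<phi> e f_borel)
      show "AE \<xi> in lborel. \<bar>deconv_density g mu_s \<xi> m - f_chi \<xi>\<bar> = \<bar>inv_fourier (?e m) \<xi>\<bar>"
        using density_eq_inv_fourier[OF chi \<phi> assms(4)] by eventually_elim (simp add: d)
    qed (rule inv_borel[OF e])
  qed
  have lim: "(\<lambda>m. Linf_norm (\<lambda>\<xi>. deconv_density g mu_s \<xi> m - f_chi \<xi>)) \<longlonglongrightarrow> Linf_norm (inv_fourier ?e_lim)"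
    unfolding norm_eq
    by (rule tendsto_Linf_norm_inv_fourier_power[OF \<phi>]) (use s s_borel in simp_all)
  have "Linf_norm (inv_fourier ?e_lim) \<le> ereal ((\<integral>t. norm (?e_lim t) \<partial>lborel) / (2 * pi))"
    by (intro Linf_norm_le inv_borel e_lim AE_I2 abs_inv_fourier_le)
  with Linf_norm_nonneg[of "inv_fourier ?e_lim"]
  obtain L where L: "Linf_norm (inv_fourier ?e_lim) = ereal L" "0 \<le> L"
    by (cases "Linf_norm (inv_fourier ?e_lim)") auto
  have zero: "Linf_norm (inv_fourier ?e_lim) = 0"
    if null: "{t::real. ereal t \<in> char_zeros mu - char_zeros chi} \<in> null_sets lebesgue"
  proof -
    have "AE t in lebesgue. ?e_lim t = 0"
      using AE_not_in[OF null]
    proof eventually_elim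
      case (elim t)
      show ?case
      proof (cases "s t = 0")
        case True
        then have "ereal t \<in> char_zeros mu"
          unfolding zeros[symmetric] by (simp add: ereal_in_char_zeros_iff s(1))
        with elim show ?thesis by (simp add: ereal_in_char_zeros_iff)
      qed simp
    qed
    then have "AE t in lborel. ?e_lim t = 0" by (simp only: AE_completion_iff)
    then have "AE t in lborel. iexp (- (t * x)) * ?e_lim t = 0" for x
      by eventually_elim simp
    then have "inv_fourier ?e_lim x = 0" for x
      unfolding inv_fourier_def by (simp only: integral_eq_zero_AE) simp
    then have "Linf_norm (inv_fourier ?e_lim) \<le> ereal 0"
      by (intro Linf_norm_le inv_borel e_lim) simp
    then show ?thesis using Linf_norm_nonneg[of "inv_fourier ?e_lim"] by (simp add: zero_ereal_def)
  qed
  show ?thesis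
  proof (intro conjI impI)
    show "\<exists>L::real. 0 \<le> L \<and>
        (\<lambda>m. Linf_norm (\<lambda>\<xi>. deconv_density g mu_s \<xi> m - f_chi \<xi>)) \<longlonglongrightarrow> ereal L"
      using lim L by (intro exI[of _ L]) simp
    show "(\<lambda>m. Linf_norm (\<lambda>\<xi>. deconv_density g mu_s \<xi> m - f_chi \<xi>)) \<longlonglongrightarrow> 0"
      if "{t::real. ereal t \<in> char_zeros mu - char_zeros chi} \<in> null_sets lebesgue"
      using lim unfolding zero[OF that] .
  qed
qed

end
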